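(* Let $\varepsilon$ be a random variable supported on $\mathbb{R}^d$. Over base models $\{F_i\}_{i=1}^N$ with confidence functions $\{f_i\}_{i=1}^N$, let $\mathcal{M}_{\mathrm{MME}}$ be the Max-Margin Ensemble and $\mathcal{M}_{\mathrm{WE}}$ the Weighted Ensemble with weights $\{w_i\}_{i=1}^N$. Let $\mathbf{x}_0\in\mathbb{R}^d$ be the input with ground-truth label $y_0\in[C]$. Suppose $\mathcal{M}_{\mathrm{WE}}$ is $(\varepsilon,\lambda_1,p)$-WE confident and $\mathcal{M}_{\mathrm{MME}}$ is $(\varepsilon,\lambda_2,p)$-MME confident at $\mathbf{x}_0$. Assume that $\{f_i(\mathbf{x}_0+\varepsilon)_{y_0}\}_{i=1}^N$ are i.i.d. and follow a symmetric distribution with mean $\mu$ and variance $s^2$, where $\mu>\max\{(1+\lambda_1^{-1})^{-1},(1+\lambda_2^{-1})^{-1}\}$. Define $s_f^2=\mathrm{Var}(\min_{i\in[N]}f_i(\mathbf{x}_0+\varepsilon)_{y_0})$ and assume $s_f<s$. (i) When $$\frac{\lambda_1}{\lambda_2}<\lambda_2^{-1}\left(\left(\frac{s}{s_f}\left(\mu-(1+\lambda_2^{-1})^{-1}\right)+1-\mu\right)^{-1}-1\right),$$ then for any weights $\{w_i\}_{i=1}^N$, $\mathcal{M}_{\mathrm{WE}}$ has higher certified robustness than $\mathcal{M}_{\mathrm{MME}}$. (ii) When $$\frac{\lambda_1}{\lambda_2}>\lambda_2^{-1}\left(\left(\frac{s}{\sqrt N s_f}\left(\mu-(1+\lambda_2^{-1})^{-1}\right)+1-\mu\right)^{-1}-1\right),$$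 then for any weights $\{w_i\}_{i=1}^N$, $\mathcal{M}_{\mathrm{MME}}$ has higher certified robustness than $\mathcal{M}_{\mathrm{WE}}$. Here the certified robustness of $\mathcal{M}_{\mathrm{WE}}$ and of $\mathcal{M}_{\mathrm{MME}}$ are, respectively, the lower bounds on the probabilities of correct prediction $\Pr_\varepsilon(\mathcal{M}(\mathbf{x}_0+\varepsilon)=y_0)$ given by $$1-p-\frac{\|\mathbf{w}\|_2^2}{\|\mathbf{w}\|_1^2}\cdot\frac{s^2}{2\left(\mu-(1+\lambda_1^{-1})^{-1}\right)^2}\qquad\text{and}\qquad 1-p-\frac{s_f^2}{2\left(\mu-(1+\lambda_2^{-1})^{-1}\right)^2},$$ and "higher" means strictly larger.
   Context: Classification with $C$ classes, $[C]=\{1,\dots,C\}$. A model has a confidence function $f:\mathbb{R}^d\to\Delta^C=\{\mathbf{p}\in\mathbb{R}^C_{\ge0}:\|\mathbf{p}\|_1=1\}$, prediction $F(\mathbf{x})=\arg\max_{i\in[C]}f(\mathbf{x})_i$, runner-up $F^{(2)}(\mathbf{x})=\arg\max_{i\ne F(\mathbf{x})}f(\mathbf{x})_i$. Weighted Ensemble with weights $w_j>0$: $\mathcal{M}_{\mathrm{WE}}(\mathbf{x}):=\arg\max_{i\in[C]}\sum_{j=1}^N w_jf_j(\mathbf{x})_i$. Max-Margin Ensemble: $\mathcal{M}_{\mathrm{MME}}(\mathbf{x}):=F_c(\mathbf{x})$ where $c=\arg\max_{i\in[N]}(f_i(\mathbf{x})_{F_i(\mathbf{x})}-f_i(\mathbf{x})_{F_i^{(2)}(\mathbf{x})})$.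 $\mathbf{w}=(w_1,\dots,w_N)$. $\mathcal{M}_{\mathrm{WE}}$ is $(\varepsilon,\lambda,p)$-WE confident at $\mathbf{x}_0$ if $\Pr_\varepsilon\Big(\max_{y_j\in[C]:y_j\ne y_0}\sum_{i=1}^Nw_if_i(\mathbf{x}_0+\varepsilon)_{y_j}\le\lambda\sum_{i=1}^Nw_i(1-f_i(\mathbf{x}_0+\varepsilon)_{y_0})\Big)=1-p$. $\mathcal{M}_{\mathrm{MME}}$ is $(\varepsilon,\lambda,p)$-MME confident at $\mathbf{x}_0$ if $\Pr_\varepsilon\Big(\bigwedge_{i\in[N]}\big(\max_{y_j\in[C]:y_j\ne y_0}f_i(\mathbf{x}_0+\varepsilon)_{y_j}\le\lambda(1-f_i(\mathbf{x}_0+\varepsilon)_{y_0})\big)\Big)=1-p$. Here $\lambda_1,\lambda_2>0$. *)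

theory Defs
  imports "HOL-Probability.Probability"
begin

(* Class labels are the elements of a finite type 'c, the base models of the
   ensemble are indexed by a finite type 'n.  Ties in an arg max are broken by
   ARG_MAX, i.e. by an unspecified but fixed choice among the maximisers. *)

definition l1_norm :: "real ^ 'k::finite \<Rightarrow> real" where
  "l1_norm v = (\<Sum>i\<in>UNIV. \<bar>v $ i\<bar>)"

definition simplex_vecs :: "(real ^ 'c::finite) set" where
  "simplex_vecs = {v. (\<forall>i. 0 \<le> v $ i) \<and> l1_norm v = 1}"

definition prediction :: "('x \<Rightarrow> real ^ 'c::finite) \<Rightarrow> 'x \<Rightarrow> 'c" where
  "prediction f x = (ARG_MAX (\<lambda>i. f x $ i) i. True)"

definition runner_up :: "('x \<Rightarrow> real ^ 'c::finite) \<Rightarrow> 'x \<Rightarrow> 'c" where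
  "runner_up f x = (ARG_MAX (\<lambda>i. f x $ i) i. i \<noteq> prediction f x)"

definition margin :: "('x \<Rightarrow> real ^ 'c::finite) \<Rightarrow> 'x \<Rightarrow> real" where
  "margin f x = f x $ prediction f x - f x $ runner_up f x"

definition weighted_ensemble ::
    "real ^ 'n::finite \<Rightarrow> ('n \<Rightarrow> 'x \<Rightarrow> real ^ 'c::finite) \<Rightarrow> 'x \<Rightarrow> 'c" where
  "weighted_ensemble w f x = (ARG_MAX (\<lambda>i. \<Sum>j\<in>UNIV. w $ j * f j x $ i) i. True)"

definition max_margin_ensemble ::
    "('n::finite \<Rightarrow> 'x \<Rightarrow> real ^ 'c::finite) \<Rightarrow> 'x \<Rightarrow> 'c" where
  "max_margin_ensemble f x = prediction (f (ARG_MAX (\<lambda>i. margin (f i) x) i. True)) x"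

definition WE_confident ::
    "'a measure \<Rightarrow> ('a \<Rightarrow> 'x::plus) \<Rightarrow> real \<Rightarrow> real \<Rightarrow> real ^ 'n::finite
      \<Rightarrow> ('n \<Rightarrow> 'x \<Rightarrow> real ^ 'c::finite) \<Rightarrow> 'x \<Rightarrow> 'c \<Rightarrow> bool" where
  "WE_confident M \<epsilon> l p w f x0 y0 \<longleftrightarrow>
     measure M {\<omega> \<in> space M.
       (MAX y\<in>UNIV - {y0}. \<Sum>i\<in>UNIV. w $ i * f i (x0 + \<epsilon> \<omega>) $ y)
         \<le> l * (\<Sum>i\<in>UNIV. w $ i * (1 - f i (x0 + \<epsilon> \<omega>) $ y0))} = 1 - p"

definition MME_confident ::
    "'a measure \<Rightarrow> ('a \<Rightarrow> 'x::plus) \<Rightarrow> real \<Rightarrow> real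
      \<Rightarrow> ('n::finite \<Rightarrow> 'x \<Rightarrow> real ^ 'c::finite) \<Rightarrow> 'x \<Rightarrow> 'c \<Rightarrow> bool" where
  "MME_confident M \<epsilon> l p f x0 y0 \<longleftrightarrow>
     measure M {\<omega> \<in> space M.
       \<forall>i. (MAX y\<in>UNIV - {y0}. f i (x0 + \<epsilon> \<omega>) $ y)
             \<le> l * (1 - f i (x0 + \<epsilon> \<omega>) $ y0)} = 1 - p"

definition iid :: "'a measure \<Rightarrow> ('n \<Rightarrow> 'a \<Rightarrow> real) \<Rightarrow> bool" where
  "iid M X \<longleftrightarrow> prob_space.indep_vars M (\<lambda>_. borel) X UNIV
     \<and> (\<forall>i j. distr M borel (X i) = distr M borel (X j))"

(* Invariance under reflection at some centre; the centre is then the mean,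
   whenever the mean exists. *)
definition symmetric_distribution :: "real measure \<Rightarrow> bool" where
  "symmetric_distribution D \<longleftrightarrow> (\<exists>c. distr D borel (\<lambda>x. 2 * c - x) = D)"

definition WE_certified :: "real \<Rightarrow> real \<Rightarrow> real \<Rightarrow> real \<Rightarrow> real ^ 'n::finite \<Rightarrow> real" where
  "WE_certified p l \<mu> s w =
     1 - p - (norm w)\<^sup>2 / (l1_norm w)\<^sup>2 * (s\<^sup>2 / (2 * (\<mu> - inverse (1 + inverse l))\<^sup>2))"

definition MME_certified :: "real \<Rightarrow> real \<Rightarrow> real \<Rightarrow> real \<Rightarrow> real" where
  "MME_certified p l \<mu> sf =
     1 - p - sf\<^sup>2 / (2 * (\<mu> - inverse (1 + inverse l))\<^sup>2)"

end

theory Submission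
  imports Defs
begin

text \<open>Write \<open>X\<^sub>i\<close> for the confidence of model \<open>i\<close> in \<open>y\<^sub>0\<close> and \<open>t\<^sub>k = (1 + 1 / l\<^sub>k)\<^sup>-\<^sup>1\<close>. On the
  confidence event, an error of the weighted ensemble forces the weighted mean of the \<open>X\<^sub>i\<close> below
  \<open>t\<^sub>1\<close>, and an error of the max-margin ensemble forces \<open>min X + max X \<le> 2 t\<^sub>2\<close>. Both the weighted
  mean and \<open>min X + max X\<close> are symmetric, because the joint law of the \<open>X\<^sub>i\<close> is invariant under
  reflection at \<open>\<mu>\<close>; hence Chebyshev's inequality holds for one tail with an extra factor \<open>1/2\<close>.
  The factor 4 in \<open>Var (min X + max X) \<le> 4 Var (min X)\<close> cancels against the mean \<open>2 \<mu>\<close>. The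
  comparisons are algebra and \<open>1/N \<le> \<parallel>w\<parallel>\<^sub>2\<^sup>2 / \<parallel>w\<parallel>\<^sub>1\<^sup>2 \<le> 1\<close>. They need \<open>s\<^sub>f > 0\<close>: otherwise
  the \<open>X\<^sub>i\<close> would be constant and \<open>s = 0\<close>.\<close>

section \<open>Finite argmax\<close>

text \<open>On a finite type the maximum over \<open>P\<close> is attained, so the choice operator
  behind \<open>arg_max\<close> really has a maximiser to pick; the witness \<open>k\<close> keeps
  the domain nonempty.\<close>

lemma arg_max_finite:
  fixes v :: "'c::finite \<Rightarrow> 'b::linorder"
  assumes "P k"
  shows "P (arg_max v P)" and "P y \<Longrightarrow> v y \<le> v (arg_max v P)"
proof -
  have fin: "finite (v ` {x. P x})" "v ` {x. P x} \<noteq> {}"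
    using assms by auto
  obtain m where m: "P m" "v m = Max (v ` {x. P x})"
    using Max_in[OF fin] by auto
  have "is_arg_max v P m"
    unfolding is_arg_max_linorder using m Max_ge[OF fin(1)] by auto
  then have "is_arg_max v P (arg_max v P)"
    unfolding arg_max_def by (rule someI)
  then show "P (arg_max v P)" and "P y \<Longrightarrow> v y \<le> v (arg_max v P)"
    by (auto simp: is_arg_max_linorder)
qed

text \<open>The choice made by \<open>ARG_MAX\<close> depends only on the set of maximisers, and there are finitely
  many such sets.\<close>

lemma measurable_arg_max:
  fixes v :: "'c::finite \<Rightarrow> 'a \<Rightarrow> real"
  assumes [measurable]: "\<And>i. v i \<in> borel_measurable M" "\<And>i. Measurable.pred M (\<lambda>x. P x i)"
  shows "(\<lambda>x. arg_max (\<lambda>i. v i x) (P x)) \<in> measurable M (count_space UNIV)"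
proof -
  define S where "S x = {i. is_arg_max (\<lambda>i. v i x) (P x) i}" for x
  \<comment> \<open>Set equality is spelled out label by label, which makes it a finite conjunction
    of measurable conditions.\<close>
  have "Measurable.pred M (\<lambda>x. \<forall>i. (i \<in> S x) = (i \<in> T))" for T
    unfolding S_def mem_Collect_eq is_arg_max_linorder by measurable
  then have "Measurable.pred M (\<lambda>x. S x = T)" for T
    by (simp add: set_eq_iff)
  then have S: "S \<in> measurable M (count_space UNIV)"
    by (subst measurable_count_space_eq_countable)
      (auto simp: pred_def vimage_def Int_def conj_commute intro: countable_finite)
  have "(\<lambda>x. arg_max (\<lambda>i. v i x) (P x)) = (\<lambda>T. SOME i. i \<in> T) \<circ> S"
    by (simp add: fun_eq_iff arg_max_def S_def)
  also have "\<dots> \<in> measurable M (count_space UNIV)"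
    using S by (rule measurable_comp) simp
  finally show ?thesis .
qed

section \<open>Correctness of the ensembles\<close>

lemma simplex_vecs_bounds:
  assumes "v \<in> simplex_vecs"
  shows "0 \<le> v $ i" and "v $ i \<le> 1"
proof -
  have nn: "\<And>i. 0 \<le> v $ i" and s: "(\<Sum>i\<in>UNIV. v $ i) = 1"
    using assms by (auto simp: simplex_vecs_def l1_norm_def)
  have "v $ i \<le> (\<Sum>i\<in>UNIV. v $ i)"
    by (rule member_le_sum) (use nn in auto)
  with s nn show "0 \<le> v $ i" "v $ i \<le> 1" by auto
qed

lemma Max_others_leD:
  fixes v :: "'c::finite \<Rightarrow> real"
  assumes "(MAX y\<in>UNIV - {y0}. v y) \<le> b" "y \<noteq> y0"
  shows "v y \<le> b"
proof -
  have "v y \<le> (MAX y\<in>UNIV - {y0}. v y)"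
    by (rule Max_ge) (use assms(2) in auto)
  with assms(1) show ?thesis by simp
qed

text \<open>A wrong winner has a score at least that of \<open>y0\<close>, yet confidence caps it by
  \<open>l\<close> times the weighted mass missing from \<open>y0\<close>. Solving for the score of
  \<open>y0\<close> bounds it by \<open>l1_norm w * l / (1 + l)\<close>.\<close>

lemma weighted_ensemble_correct:
  assumes "(MAX y\<in>UNIV - {y0}. \<Sum>i\<in>UNIV. w $ i * f i x $ y)
      \<le> l * (\<Sum>i\<in>UNIV. w $ i * (1 - f i x $ y0))"
    and "l > 0" and "\<And>j. w $ j > 0"
    and gt: "l1_norm w * inverse (1 + inverse l) < (\<Sum>i\<in>UNIV. w $ i * f i x $ y0)"
  shows "weighted_ensemble w f x = y0"
proof (rule ccontr)
  assume ne: "weighted_ensemble w f x \<noteq> y0"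
  let ?g = "\<lambda>y. \<Sum>i\<in>UNIV. w $ i * f i x $ y"
  have "?g y0 \<le> ?g (weighted_ensemble w f x)"
    unfolding weighted_ensemble_def by (rule arg_max_finite(2)) auto
  also have "\<dots> \<le> l * (\<Sum>i\<in>UNIV. w $ i * (1 - f i x $ y0))"
    by (rule Max_others_leD[OF assms(1) ne])
  also have "\<dots> = l * (l1_norm w - ?g y0)"
    using less_imp_le[OF assms(3)] by (simp add: l1_norm_def right_diff_distrib sum_subtractf)
  finally have "?g y0 * (1 + l) \<le> l1_norm w * l"
    by (simp add: algebra_simps)
  moreover have "inverse (1 + inverse l) = l / (1 + l)"
    using \<open>l > 0\<close> by (simp add: field_simps)
  ultimately show False
    using gt \<open>l > 0\<close> by (simp add: field_simps)
qed

text \<open>A wrong model has margin at most \<open>l * (1 - q) - q\<close> and a right one at least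
  \<open>q - l * (1 - q)\<close>, where \<open>q\<close> is its confidence in \<open>y0\<close>. Comparing the model selected by margin with
  the one most confident in \<open>y0\<close> shows that an error forces the sum of the extreme confidences
  to be small.\<close>

lemma max_margin_ensemble_correct:
  fixes f :: "'n::finite \<Rightarrow> 'x \<Rightarrow> real ^ 'c::finite"
  assumes conf: "\<And>i. (MAX y\<in>UNIV - {y0}. f i x $ y) \<le> l * (1 - f i x $ y0)"
    and "l > 0" and card: "CARD('c) \<ge> 2"
    and gt: "2 * inverse (1 + inverse l) < (MIN i. f i x $ y0) + (MAX i. f i x $ y0)"
  shows "max_margin_ensemble f x = y0"
proof (rule ccontr)
  assume ne: "max_margin_ensemble f x \<noteq> y0"
  define q where "q i = f i x $ y0" for i
  define c where "c = (ARG_MAX (\<lambda>i. margin (f i) x) i. True)"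
  have top: "f i x $ y \<le> f i x $ prediction (f i) x" for i y
    unfolding prediction_def by (rule arg_max_finite(2)) auto
  \<comment> \<open>A second label guarantees that the runner-up is chosen from a nonempty
    set.\<close>
  have two: "\<exists>z. z \<noteq> y" for y :: 'c
  proof (rule ccontr)
    assume "\<not> ?thesis"
    then have "(UNIV :: 'c set) = {y}" by auto
    then have "CARD('c) = 1" by (metis card_1_singleton_iff One_nat_def)
    with card show False by simp
  qed
  have sec: "runner_up (f i) x \<noteq> prediction (f i) x"
    and sec_ge: "y \<noteq> prediction (f i) x \<Longrightarrow> f i x $ y \<le> f i x $ runner_up (f i) x" for i y
  proof -
    obtain z where z: "z \<noteq> prediction (f i) x" using two by blast
    show "runner_up (f i) x \<noteq> prediction (f i) x"
      unfolding runner_up_def using z by (rule arg_max_finite(1))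
    show "y \<noteq> prediction (f i) x \<Longrightarrow> f i x $ y \<le> f i x $ runner_up (f i) x"
      unfolding runner_up_def by (rule arg_max_finite(2)[where P = "\<lambda>j. j \<noteq> prediction (f i) x", OF z])
  qed
  have others: "y \<noteq> y0 \<Longrightarrow> f i x $ y \<le> l * (1 - q i)" for i y
    using Max_others_leD[OF conf] by (simp add: q_def)
  have "finite (range q)" "range q \<noteq> {}" by auto
  then obtain m where m: "q m = (MAX i. q i)"
    using Max_in by (metis (no_types, lifting) imageE)
  \<comment> \<open>A wrong top label has confidence at most \<open>l * (1 - q i)\<close>, while
    \<open>y0\<close> itself competes for second place, so the runner-up has at least
    \<open>q i\<close>.\<close>
  have wrong: "margin (f i) x \<le> l * (1 - q i) - q i" if "prediction (f i) x \<noteq> y0" for i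
    unfolding margin_def
    using others[OF that, of i] sec_ge[of y0 i] that by (fastforce simp: q_def)
  have "prediction (f c) x \<noteq> y0"
    using ne by (simp add: max_margin_ensemble_def c_def)
  then have c: "margin (f c) x \<le> l * (1 - q c) - q c"
    by (rule wrong)
  have best: "margin (f m) x \<le> margin (f c) x"
    unfolding c_def by (rule arg_max_finite(2)) auto
  have min: "(MIN i. q i) \<le> q c" and max: "(MIN i. q i) \<le> q m"
    by (rule Min_le; simp)+
  have "(1 + l) * ((MIN i. q i) + q m) \<le> 2 * l"
  proof (cases "prediction (f m) x = y0")
    case True
    then have "q m - l * (1 - q m) \<le> margin (f m) x"
      unfolding margin_def using others[of "runner_up (f m) x" m] sec[of m] by (simp add: q_def)
    \<comment> \<open>The selected margin lies above \<open>q m - l * (1 - q m)\<close> and below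
      \<open>l * (1 - q c) - q c\<close>; chaining the two bounds leaves the sum of the
      confidences.\<close>
    with best c have "(1 + l) * (q c + q m) \<le> 2 * l"
      by (simp add: algebra_simps)
    moreover have "(1 + l) * ((MIN i. q i) + q m) \<le> (1 + l) * (q c + q m)"
      using min \<open>l > 0\<close> by (intro mult_left_mono) auto
    ultimately show ?thesis by linarith
  next
    \<comment> \<open>If even the most confident model is wrong, its own confidence is at most
      \<open>l / (1 + l)\<close>, without any comparison of margins.\<close>
    case False
    then have "q m \<le> l * (1 - q m)"
      using others[of "prediction (f m) x" m] top[of m y0] by (simp add: q_def)
    then have "(1 + l) * (q m + q m) \<le> 2 * l"
      by (simp add: algebra_simps)
    moreover have "(1 + l) * ((MIN i. q i) + q m) \<le> (1 + l) * (q m + q m)"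
      using max \<open>l > 0\<close> by (intro mult_left_mono) auto
    ultimately show ?thesis by linarith
  qed
  moreover have "inverse (1 + inverse l) = l / (1 + l)"
    using \<open>l > 0\<close> by (simp add: field_simps)
  ultimately show False
    using gt \<open>l > 0\<close> m by (simp add: field_simps q_def)
qed

section \<open>Symmetric random variables\<close>

text \<open>Reflection at the mean gives both tails the same probability, and \<open>t\<close> below
  the mean makes them disjoint. Each therefore takes at most half of the two-sided bound.\<close>

lemma (in prob_space) Chebyshev_one_sided_symmetric:
  fixes Z :: "'a \<Rightarrow> real"
  assumes [measurable]: "random_variable borel Z"
    and int: "integrable M (\<lambda>\<omega>. (Z \<omega>)\<^sup>2)"
    and sym: "distr M borel (\<lambda>\<omega>. 2 * expectation Z - Z \<omega>) = distr M borel Z"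
    and t: "t < expectation Z"
  shows "prob {\<omega> \<in> space M. Z \<omega> \<le> t} \<le> variance Z / (2 * (expectation Z - t)\<^sup>2)"
proof -
  let ?m = "expectation Z"
  let ?L = "{\<omega> \<in> space M. Z \<omega> \<le> t}" and ?U = "{\<omega> \<in> space M. 2 * ?m - Z \<omega> \<le> t}"
  have "prob ?L = measure (distr M borel Z) {..t}"
    by (subst measure_distr) (auto simp: vimage_def Int_def intro!: arg_cong[where f = prob])
  also have "\<dots> = prob ?U"
    unfolding sym[symmetric]
    by (subst measure_distr) (auto simp: vimage_def Int_def intro!: arg_cong[where f = prob])
  finally have "2 * prob ?L = prob ?L + prob ?U" by simp
  also have "\<dots> = prob (?L \<union> ?U)"
    by (rule finite_measure_Union[symmetric]) (use t in auto)
  also have "\<dots> \<le> prob {\<omega> \<in> space M. \<bar>Z \<omega> - ?m\<bar> \<ge> ?m - t}"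
    by (rule finite_measure_mono) auto
  also have "\<dots> \<le> variance Z / (?m - t)\<^sup>2"
    by (rule Chebyshev_inequality) (use int t in auto)
  finally show ?thesis by simp
qed

text \<open>By independence the joint law is the product of the marginals, so reflecting every
  coordinate preserves it; any measurable \<open>h\<close> then inherits the invariance.\<close>

lemma (in prob_space) distr_reflected_family:
  fixes X :: "'i \<Rightarrow> 'a \<Rightarrow> real"
  assumes ind: "indep_vars (\<lambda>_. borel) X I" and "I \<noteq> {}"
    and sym: "\<And>i. i \<in> I \<Longrightarrow> distr M borel (\<lambda>\<omega>. 2 * c - X i \<omega>) = distr M borel (X i)"
    and h: "h \<in> measurable (\<Pi>\<^sub>M i\<in>I. borel) N"
  shows "distr M N (\<lambda>\<omega>. h (\<lambda>i\<in>I. 2 * c - X i \<omega>)) = distr M N (\<lambda>\<omega>. h (\<lambda>i\<in>I. X i \<omega>))"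
proof -
  have rv [measurable]: "\<And>i. i \<in> I \<Longrightarrow> random_variable borel (X i)"
    using ind by (auto simp: indep_vars_def)
  have ind': "indep_vars (\<lambda>_. borel) (\<lambda>i \<omega>. 2 * c - X i \<omega>) I"
    by (rule indep_vars_compose2[OF ind]) auto
  have "distr M (\<Pi>\<^sub>M i\<in>I. borel) (\<lambda>\<omega>. \<lambda>i\<in>I. 2 * c - X i \<omega>)
      = (\<Pi>\<^sub>M i\<in>I. distr M borel (\<lambda>\<omega>. 2 * c - X i \<omega>))"
    by (rule indep_vars_iff_distr_eq_PiM'[THEN iffD1, OF _ _ ind']) (use assms in auto)
  also have "\<dots> = (\<Pi>\<^sub>M i\<in>I. distr M borel (X i))"
    by (intro PiM_cong sym refl)
  also have "\<dots> = distr M (\<Pi>\<^sub>M i\<in>I. borel) (\<lambda>\<omega>. \<lambda>i\<in>I. X i \<omega>)"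
    by (rule indep_vars_iff_distr_eq_PiM'[THEN iffD1, OF _ _ ind, symmetric]) (use assms in auto)
  finally have eq: "distr M (\<Pi>\<^sub>M i\<in>I. borel) (\<lambda>\<omega>. \<lambda>i\<in>I. 2 * c - X i \<omega>)
      = distr M (\<Pi>\<^sub>M i\<in>I. borel) (\<lambda>\<omega>. \<lambda>i\<in>I. X i \<omega>)" .
  have "distr (distr M (\<Pi>\<^sub>M i\<in>I. borel) (\<lambda>\<omega>. \<lambda>i\<in>I. 2 * c - X i \<omega>)) N h
      = distr (distr M (\<Pi>\<^sub>M i\<in>I. borel) (\<lambda>\<omega>. \<lambda>i\<in>I. X i \<omega>)) N h"
    by (simp only: eq)
  then show ?thesis
    by (subst (asm) (1 2) distr_distr[OF h]) (auto simp: comp_def)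
qed

text \<open>The definition provides only some centre \<open>c\<close>. Taking expectations on both
  sides of the invariance gives \<open>expectation Z = 2 * c - expectation Z\<close>, which
  identifies it.\<close>

lemma (in prob_space) symmetric_distribution_reflect:
  fixes Z :: "'a \<Rightarrow> real"
  assumes "symmetric_distribution (distr M borel Z)" and int: "integrable M Z"
  shows "distr M borel (\<lambda>\<omega>. 2 * expectation Z - Z \<omega>) = distr M borel Z"
proof -
  have [measurable]: "random_variable borel Z" using int by auto
  obtain c where "distr (distr M borel Z) borel (\<lambda>x. 2 * c - x) = distr M borel Z"
    using assms(1) by (auto simp: symmetric_distribution_def)
  then have c: "distr M borel (\<lambda>\<omega>. 2 * c - Z \<omega>) = distr M borel Z"
    by (simp add: distr_distr comp_def)
  have "expectation Z = (\<integral>x. x \<partial>distr M borel Z)"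
    by (simp add: integral_distr)
  also have "\<dots> = expectation (\<lambda>\<omega>. 2 * c - Z \<omega>)"
    unfolding c[symmetric] by (simp add: integral_distr)
  also have "\<dots> = 2 * c - expectation Z"
    using int by (simp add: prob_space)
  finally have "expectation Z = c" by simp
  with c show ?thesis by simp
qed

section \<open>Variances\<close>

text \<open>The product is dominated by the sum of the squares. This handles the cross terms when
  squares of sums are expanded.\<close>

lemma integrable_mult_squares:
  fixes U V :: "'a \<Rightarrow> real"
  assumes [measurable]: "U \<in> borel_measurable M" "V \<in> borel_measurable M"
    and sq: "integrable M (\<lambda>\<omega>. (U \<omega>)\<^sup>2)" "integrable M (\<lambda>\<omega>. (V \<omega>)\<^sup>2)"
  shows "integrable M (\<lambda>\<omega>. U \<omega> * V \<omega>)"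
proof (rule Bochner_Integration.integrable_bound)
  show "integrable M (\<lambda>\<omega>. (U \<omega>)\<^sup>2 + (V \<omega>)\<^sup>2)" using sq by auto
  have "\<bar>a * b\<bar> \<le> a\<^sup>2 + b\<^sup>2" for a b :: real
  proof -
    have "2 * (\<bar>a\<bar> * \<bar>b\<bar>) \<le> a\<^sup>2 + b\<^sup>2"
      using sum_squares_bound[of "\<bar>a\<bar>" "\<bar>b\<bar>"] by (simp add: mult.assoc)
    moreover have "0 \<le> \<bar>a\<bar> * \<bar>b\<bar>" by simp
    ultimately show ?thesis unfolding abs_mult by linarith
  qed
  then show "AE \<omega> in M. norm (U \<omega> * V \<omega>) \<le> norm ((U \<omega>)\<^sup>2 + (V \<omega>)\<^sup>2)"
    by simp
qed simp

text \<open>After centring, independence makes the expectation of each product of distinct terms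
  factor into zeros, so only the diagonal of the expanded square survives.\<close>

lemma (in prob_space) variance_weighted_sum_indep:
  fixes X :: "'i \<Rightarrow> 'a \<Rightarrow> real"
  assumes "finite I" and ind: "indep_vars (\<lambda>_. borel) X I"
    and sq: "\<And>i. i \<in> I \<Longrightarrow> integrable M (\<lambda>\<omega>. (X i \<omega>)\<^sup>2)"
  shows "variance (\<lambda>\<omega>. \<Sum>i\<in>I. a i * X i \<omega>) = (\<Sum>i\<in>I. (a i)\<^sup>2 * variance (X i))"
proof -
  have rv [measurable]: "\<And>i. i \<in> I \<Longrightarrow> random_variable borel (X i)"
    using ind by (auto simp: indep_vars_def)
  have int: "integrable M (X i)" if "i \<in> I" for i
    using square_integrable_imp_integrable[OF rv[OF that] sq[OF that]] .
  define Y where "Y i \<omega> = X i \<omega> - expectation (X i)" for i \<omega>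
  have indY: "indep_vars (\<lambda>_. borel) Y I"
    unfolding Y_def by (rule indep_vars_compose2[OF ind]) auto
  have intY: "integrable M (Y i)" and EY: "expectation (Y i) = 0" if "i \<in> I" for i
    using int[OF that] by (auto simp: Y_def[abs_def] prob_space)
  have YY: "integrable M (\<lambda>\<omega>. Y i \<omega> * Y j \<omega>)
      \<and> expectation (\<lambda>\<omega>. Y i \<omega> * Y j \<omega>) = (if i = j then variance (X i) else 0)"
    if "i \<in> I" "j \<in> I" for i j
  proof (cases "i = j")
    case True
    have "integrable M (\<lambda>\<omega>. (Y i \<omega>)\<^sup>2)"
      using int[OF that(1)] sq[OF that(1)] by (auto simp: Y_def power2_diff)
    with True show ?thesis by (auto simp: Y_def power2_eq_square)
  next
    case False
    have ind2: "indep_vars (\<lambda>_. borel) Y {i, j}"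
      by (rule indep_vars_subset[OF indY]) (use that in auto)
    have i2: "\<And>k. k \<in> {i, j} \<Longrightarrow> integrable M (Y k)" using that intY by auto
    show ?thesis
      using indep_vars_lebesgue_integral[OF _ ind2 i2] indep_vars_integrable[OF _ ind2 i2] False EY that
      by auto
  qed
  have "expectation (\<lambda>\<omega>. \<Sum>i\<in>I. a i * X i \<omega>) = (\<Sum>i\<in>I. a i * expectation (X i))"
    using int by simp
  then have "variance (\<lambda>\<omega>. \<Sum>i\<in>I. a i * X i \<omega>) = expectation (\<lambda>\<omega>. (\<Sum>i\<in>I. a i * Y i \<omega>)\<^sup>2)"
    by (simp add: Y_def right_diff_distrib sum_subtractf)
  also have "\<dots> = expectation (\<lambda>\<omega>. \<Sum>i\<in>I. \<Sum>j\<in>I. (a i * a j) * (Y i \<omega> * Y j \<omega>))"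
    by (simp add: power2_eq_square sum_product mult_ac)
  also have "\<dots> = (\<Sum>i\<in>I. \<Sum>j\<in>I. (a i * a j) * (if i = j then variance (X i) else 0))"
    using YY by (simp add: Bochner_Integration.integral_sum)
  also have "\<dots> = (\<Sum>i\<in>I. (a i)\<^sup>2 * variance (X i))"
    using \<open>finite I\<close> by (simp add: power2_eq_square if_distrib[of "(*) _"] cong: if_cong)
  finally show ?thesis .
qed

text \<open>The inequality \<open>(u + v)\<^sup>2 \<le> 2 * u\<^sup>2 + 2 * v\<^sup>2\<close> for
  the centred variables needs no independence, so the bound applies to the minimum and maximum of
  one family.\<close>

lemma (in prob_space) variance_add_le:
  fixes U V :: "'a \<Rightarrow> real"
  assumes [measurable]: "random_variable borel U" "random_variable borel V"
    and sq: "integrable M (\<lambda>\<omega>. (U \<omega>)\<^sup>2)" "integrable M (\<lambda>\<omega>. (V \<omega>)\<^sup>2)"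
  shows "variance (\<lambda>\<omega>. U \<omega> + V \<omega>) \<le> 2 * variance U + 2 * variance V"
proof -
  have int: "integrable M U" "integrable M V"
    using square_integrable_imp_integrable assms by blast+
  let ?u = "\<lambda>\<omega>. U \<omega> - expectation U" and ?v = "\<lambda>\<omega>. V \<omega> - expectation V"
  have i: "integrable M (\<lambda>\<omega>. (?u \<omega>)\<^sup>2)" "integrable M (\<lambda>\<omega>. (?v \<omega>)\<^sup>2)"
    using int sq by (auto simp: power2_diff)
  have le: "(?u \<omega> + ?v \<omega>)\<^sup>2 \<le> 2 * (?u \<omega>)\<^sup>2 + 2 * (?v \<omega>)\<^sup>2" for \<omega>
    using zero_le_power2[of "?u \<omega> - ?v \<omega>"] by (simp add: power2_eq_square algebra_simps)
  have "variance (\<lambda>\<omega>. U \<omega> + V \<omega>) = expectation (\<lambda>\<omega>. (?u \<omega> + ?v \<omega>)\<^sup>2)"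
    using int by (simp add: algebra_simps)
  also have "\<dots> \<le> expectation (\<lambda>\<omega>. 2 * (?u \<omega>)\<^sup>2 + 2 * (?v \<omega>)\<^sup>2)"
    by (rule integral_mono') (use i le in auto)
  also have "\<dots> = 2 * variance U + 2 * variance V"
    using i by simp
  finally show ?thesis .
qed

text \<open>If the minimum equals \<open>m\<close> almost surely, then by independence some \<open>X i\<close> exceeds \<open>m\<close> with
  probability zero, hence so do all of them.\<close>

lemma (in prob_space) iid_variance_Min_eq_0:
  fixes X :: "'n::finite \<Rightarrow> 'a \<Rightarrow> real"
  assumes iid: "iid M X" and sq: "integrable M (\<lambda>\<omega>. (MIN i. X i \<omega>)\<^sup>2)"
    and var: "variance (\<lambda>\<omega>. MIN i. X i \<omega>) = 0"
  shows "variance (X i) = 0"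
proof -
  have ind: "indep_vars (\<lambda>_. borel) X UNIV"
    and id: "\<And>i j. distr M borel (X i) = distr M borel (X j)"
    using iid by (auto simp: iid_def)
  have [measurable]: "\<And>i. random_variable borel (X i)"
    using ind by (auto simp: indep_vars_def)
  let ?Y = "\<lambda>\<omega>. MIN i. X i \<omega>"
  define m where "m = expectation ?Y"
  have [measurable]: "random_variable borel ?Y" by simp
  have "integrable M ?Y"
    by (rule square_integrable_imp_integrable[OF _ sq]) simp
  then have "integrable M (\<lambda>\<omega>. (?Y \<omega> - m)\<^sup>2)"
    using sq by (auto simp: power2_diff)
  then have "AE \<omega> in M. (?Y \<omega> - m)\<^sup>2 = 0"
    using var unfolding m_def[symmetric] by (subst (asm) integral_nonneg_eq_0_iff_AE) auto
  then have Ym: "AE \<omega> in M. ?Y \<omega> = m" by simp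
  have "prob (\<Inter>i\<in>UNIV. X i -` {m<..} \<inter> space M) = 0"
  proof -
    have "AE \<omega> in M. \<omega> \<notin> (\<Inter>i\<in>UNIV. X i -` {m<..} \<inter> space M)"
      using Ym
    proof eventually_elim
      case (elim \<omega>)
      have "?Y \<omega> \<in> range (\<lambda>i. X i \<omega>)" by (rule Min_in) auto
      with elim show ?case by auto
    qed
    moreover have "(\<Inter>i\<in>UNIV. X i -` {m<..} \<inter> space M) \<in> events"
      by (intro sets.finite_INT) auto
    ultimately show ?thesis
      by (simp add: prob_eq_0)
  qed
  then have "(\<Prod>i\<in>UNIV. prob (X i -` {m<..} \<inter> space M)) = 0"
    by (subst indep_varsD_finite[OF ind, symmetric]) auto
  \<comment> \<open>A vanishing finite product has a zero factor; equality of the distributions then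
    carries it from \<open>j\<close> to the given \<open>i\<close>.\<close>
  then obtain j where "prob (X j -` {m<..} \<inter> space M) = 0" by auto
  moreover have "prob (X k -` {m<..} \<inter> space M) = measure (distr M borel (X k)) {m<..}" for k
    by (simp add: measure_distr)
  ultimately have "prob (X i -` {m<..} \<inter> space M) = 0"
    using id[of i j] by simp
  then have "AE \<omega> in M. \<omega> \<notin> X i -` {m<..} \<inter> space M"
    by (subst (asm) prob_eq_0) auto
  with Ym AE_space have Xm: "AE \<omega> in M. X i \<omega> = m"
  proof eventually_elim
    case (elim \<omega>)
    have "?Y \<omega> \<le> X i \<omega>" by (rule Min_le) auto
    with elim show ?case by auto
  qed
  then have "expectation (X i) = expectation (\<lambda>_. m)"
    by (intro integral_cong_AE) auto
  then have E: "expectation (X i) = m" by (simp add: prob_space)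
  have "variance (X i) = expectation (\<lambda>_. 0)"
    by (rule integral_cong_AE) (use Xm in \<open>auto simp: E\<close>)
  then show ?thesis by simp
qed

section \<open>Certified robustness\<close>

text \<open>A union bound, meant for \<open>A\<close> the confidence event, \<open>B\<close> correct
  prediction and \<open>C\<close> the tail event.\<close>

lemma (in prob_space) prob_ge_diff:
  assumes "A \<in> events" "B \<in> events" "C \<in> events" "A \<subseteq> B \<union> C"
  shows "prob A - prob C \<le> prob B"
proof -
  have "prob A \<le> prob (B \<union> C)" using assms by (intro finite_measure_mono) auto
  also have "\<dots> \<le> prob B + prob C" using assms by (intro measure_Un_le) auto
  finally show ?thesis by simp
qed

lemma norm_vec_squared: "(norm (w :: real ^ 'n))\<^sup>2 = (\<Sum>i\<in>UNIV. (w $ i)\<^sup>2)"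
  by (simp add: norm_vec_def L2_set_def sum_nonneg)

text \<open>The second bound is Cauchy-Schwarz against the constant vector.\<close>

lemma l1_norm_bounds:
  fixes w :: "real ^ 'n"
  shows "norm w \<le> l1_norm w" and "(l1_norm w)\<^sup>2 \<le> CARD('n) * (norm w)\<^sup>2"
proof -
  show "norm w \<le> l1_norm w"
    unfolding l1_norm_def by (rule norm_le_l1_cart)
  show "(l1_norm w)\<^sup>2 \<le> CARD('n) * (norm w)\<^sup>2"
    unfolding l1_norm_def norm_vec_squared
    using sum_squared_le_sum_of_squares[of "\<lambda>i. \<bar>w $ i\<bar>" UNIV] by (simp add: mult.commute)
qed

section \<open>Tail bounds for an iid family with symmetric law\<close>

context prob_space
begin

context
  fixes X :: "'n::finite \<Rightarrow> 'a \<Rightarrow> real" and \<mu> s :: real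
  assumes iid: "iid M X"
    and sym: "\<And>i. symmetric_distribution (distr M borel (X i))"
    and mean: "\<And>i. expectation (X i) = \<mu>"
    and sq: "\<And>i. integrable M (\<lambda>\<omega>. (X i \<omega>)\<^sup>2)"
begin

lemma iid_rv [measurable]: "random_variable borel (X i)"
  and iid_indep: "indep_vars (\<lambda>_. borel) X UNIV"
  using iid by (auto simp: iid_def indep_vars_def)

lemma iid_integrable: "integrable M (X i)"
  using square_integrable_imp_integrable[OF iid_rv sq] .

text \<open>Over \<open>UNIV\<close> restriction is the identity, and the centre of every marginal
  is the common mean.\<close>

lemma iid_reflect:
  assumes "h \<in> measurable (\<Pi>\<^sub>M i\<in>UNIV. borel) borel"
  shows "distr M borel (\<lambda>\<omega>. h (\<lambda>i. 2 * \<mu> - X i \<omega>)) = distr M borel (\<lambda>\<omega>. h (\<lambda>i. X i \<omega>))"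
proof -
  have "restrict g UNIV = g" for g :: "'n \<Rightarrow> real"
    by (simp add: restrict_def)
  then show ?thesis
    using distr_reflected_family[OF iid_indep _ _ assms, of \<mu>]
      symmetric_distribution_reflect[OF sym iid_integrable] mean by simp
qed

text \<open>Mean and threshold both scale with \<open>l1_norm w\<close>, while the variance is
  \<open>(norm w)\<^sup>2 * s\<^sup>2\<close>; one-sided Chebyshev leaves the quotient of the
  squared norms.\<close>

lemma weighted_sum_tail:
  assumes pos: "\<And>j. w $ j > 0" and var: "\<And>i. variance (X i) = s\<^sup>2" and t: "t < \<mu>"
  shows "prob {\<omega> \<in> space M. (\<Sum>i\<in>UNIV. w $ i * X i \<omega>) \<le> l1_norm w * t}
    \<le> (norm w)\<^sup>2 / (l1_norm w)\<^sup>2 * (s\<^sup>2 / (2 * (\<mu> - t)\<^sup>2))"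
proof -
  let ?Z = "\<lambda>\<omega>. \<Sum>i\<in>UNIV. w $ i * X i \<omega>"
  have W: "l1_norm w = (\<Sum>i\<in>UNIV. w $ i)"
    using less_imp_le[OF pos] by (simp add: l1_norm_def)
  then have Wpos: "l1_norm w > 0" using pos by (simp add: sum_pos)
  have EZ: "expectation ?Z = l1_norm w * \<mu>"
    using iid_integrable by (simp add: mean W sum_distrib_right)
  have VZ: "variance ?Z = (norm w)\<^sup>2 * s\<^sup>2"
    using variance_weighted_sum_indep[OF _ iid_indep sq, of "\<lambda>i. w $ i"]
    by (simp add: var norm_vec_squared sum_distrib_right)
  have "distr M borel (\<lambda>\<omega>. \<Sum>i\<in>UNIV. w $ i * (2 * \<mu> - X i \<omega>)) = distr M borel ?Z"
    using iid_reflect[of "\<lambda>x. \<Sum>i\<in>UNIV. w $ i * x i"] by simp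
  moreover have "(\<Sum>i\<in>UNIV. w $ i * (2 * \<mu> - X i \<omega>)) = 2 * expectation ?Z - ?Z \<omega>" for \<omega>
    unfolding EZ by (simp add: right_diff_distrib sum_subtractf W sum_distrib_right sum_distrib_left mult_ac)
  ultimately have refl: "distr M borel (\<lambda>\<omega>. 2 * expectation ?Z - ?Z \<omega>) = distr M borel ?Z"
    by simp
  have XX: "integrable M (\<lambda>\<omega>. X i \<omega> * X j \<omega>)" for i j
    by (rule integrable_mult_squares) (use sq in auto)
  have "(?Z \<omega>)\<^sup>2 = (\<Sum>i\<in>UNIV. \<Sum>j\<in>UNIV. (w $ i * w $ j) * (X i \<omega> * X j \<omega>))" for \<omega>
    by (simp add: power2_eq_square sum_product mult_ac)
  then have sqZ: "integrable M (\<lambda>\<omega>. (?Z \<omega>)\<^sup>2)"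
    using XX by simp
  have "prob {\<omega> \<in> space M. ?Z \<omega> \<le> l1_norm w * t}
      \<le> variance ?Z / (2 * (expectation ?Z - l1_norm w * t)\<^sup>2)"
    by (rule Chebyshev_one_sided_symmetric[OF _ sqZ refl]) (use Wpos t EZ in auto)
  also have "\<dots> = (norm w)\<^sup>2 / (l1_norm w)\<^sup>2 * (s\<^sup>2 / (2 * (\<mu> - t)\<^sup>2))"
    unfolding VZ unfolding EZ right_diff_distrib[symmetric] by (simp add: power_mult_distrib)
  finally show ?thesis .
qed

text \<open>The squared minimum is one of the squares and so is dominated by their sum.\<close>

lemma Min_square_integrable: "integrable M (\<lambda>\<omega>. (MIN i. X i \<omega>)\<^sup>2)"
proof (rule Bochner_Integration.integrable_bound)
  show "integrable M (\<lambda>\<omega>. \<Sum>i\<in>UNIV. (X i \<omega>)\<^sup>2)" using sq by auto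
  have "(MIN i. X i \<omega>)\<^sup>2 \<le> (\<Sum>i\<in>UNIV. (X i \<omega>)\<^sup>2)" for \<omega>
  proof -
    have "(MIN i. X i \<omega>) \<in> range (\<lambda>i. X i \<omega>)" by (rule Min_in) auto
    then obtain j where j: "(MIN i. X i \<omega>) = X j \<omega>" by (elim imageE)
    have "(X j \<omega>)\<^sup>2 \<le> (\<Sum>i\<in>UNIV. (X i \<omega>)\<^sup>2)"
      by (rule member_le_sum) auto
    with j show ?thesis by simp
  qed
  then show "AE \<omega> in M. norm ((MIN i. X i \<omega>)\<^sup>2) \<le> norm (\<Sum>i\<in>UNIV. (X i \<omega>)\<^sup>2)"
    by (simp add: sum_nonneg)
qed simp

text \<open>The minimum alone is not symmetric, but reflection at \<open>\<mu>\<close> exchanges it with the maximum.\<close>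

lemma Min_plus_Max_tail:
  assumes t: "t < \<mu>"
  shows "prob {\<omega> \<in> space M. (MIN i. X i \<omega>) + (MAX i. X i \<omega>) \<le> 2 * t}
    \<le> variance (\<lambda>\<omega>. MIN i. X i \<omega>) / (2 * (\<mu> - t)\<^sup>2)"
proof -
  let ?L = "\<lambda>\<omega>. MIN i. X i \<omega>" and ?U = "\<lambda>\<omega>. MAX i. X i \<omega>"
  have Min_refl: "(MIN i. 2 * \<mu> - g i) = 2 * \<mu> - (MAX i. g i)"
    and Max_refl: "(MAX i. 2 * \<mu> - g i) = 2 * \<mu> - (MIN i. g i)" for g :: "'n \<Rightarrow> real"
  proof -
    have "Max (range g) \<in> range g" "Min (range g) \<in> range g" by (auto intro: Max_in Min_in)
    then obtain a b where ab: "Max (range g) = g a" "Min (range g) = g b" by (elim imageE)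
    have "g i \<le> g a" "g b \<le> g i" for i
      unfolding ab[symmetric] by (auto intro: Max_ge Min_le)
    with ab show "(MIN i. 2 * \<mu> - g i) = 2 * \<mu> - (MAX i. g i)"
        "(MAX i. 2 * \<mu> - g i) = 2 * \<mu> - (MIN i. g i)"
      by (auto intro!: Min_eqI Max_eqI)
  qed
  have mMin: "(\<lambda>x. MIN i. x i) \<in> measurable (\<Pi>\<^sub>M i\<in>(UNIV :: 'n set). borel) (borel :: real measure)"
    and mMax: "(\<lambda>x. MAX i. x i) \<in> measurable (\<Pi>\<^sub>M i\<in>(UNIV :: 'n set). borel) (borel :: real measure)"
    by (rule borel_measurable_Min borel_measurable_Max; simp)+
  have rU: "distr M borel (\<lambda>\<omega>. 2 * \<mu> - ?L \<omega>) = distr M borel ?U"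
    using iid_reflect[OF mMax] by (simp add: Max_refl)
  have [measurable]: "random_variable borel ?L" "random_variable borel ?U" by simp_all
  have iL: "integrable M ?L"
    by (rule square_integrable_imp_integrable[OF _ Min_square_integrable]) simp
  \<comment> \<open>The maximum agrees with the reflected minimum only in law, so integrability and
    moments are carried over through the distribution.\<close>
  have transfer: "expectation (\<lambda>\<omega>. g (?U \<omega>)) = expectation (\<lambda>\<omega>. g (2 * \<mu> - ?L \<omega>))"
      "integrable M (\<lambda>\<omega>. g (?U \<omega>)) \<longleftrightarrow> integrable M (\<lambda>\<omega>. g (2 * \<mu> - ?L \<omega>))"
    if [measurable]: "g \<in> borel_measurable borel" for g :: "real \<Rightarrow> real"
  proof -
    have "expectation (\<lambda>\<omega>. g (?U \<omega>)) = (\<integral>x. g x \<partial>distr M borel ?U)"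
      by (simp add: integral_distr)
    also have "\<dots> = expectation (\<lambda>\<omega>. g (2 * \<mu> - ?L \<omega>))"
      unfolding rU[symmetric] by (simp add: integral_distr)
    finally show "expectation (\<lambda>\<omega>. g (?U \<omega>)) = expectation (\<lambda>\<omega>. g (2 * \<mu> - ?L \<omega>))" .
    have "integrable M (\<lambda>\<omega>. g (?U \<omega>)) \<longleftrightarrow> integrable (distr M borel ?U) g"
      by (simp add: integrable_distr_eq)
    also have "\<dots> \<longleftrightarrow> integrable M (\<lambda>\<omega>. g (2 * \<mu> - ?L \<omega>))"
      unfolding rU[symmetric] by (simp add: integrable_distr_eq)
    finally show "integrable M (\<lambda>\<omega>. g (?U \<omega>)) \<longleftrightarrow> integrable M (\<lambda>\<omega>. g (2 * \<mu> - ?L \<omega>))" .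
  qed
  have iU: "integrable M ?U"
    using transfer(2)[of "\<lambda>x. x"] iL by simp
  have sqU: "integrable M (\<lambda>\<omega>. (?U \<omega>)\<^sup>2)"
    using transfer(2)[of "\<lambda>x. x\<^sup>2"] iL Min_square_integrable by (simp add: power2_diff)
  have EU: "expectation ?U = 2 * \<mu> - expectation ?L"
    using transfer(1)[of "\<lambda>x. x"] iL by (simp add: prob_space)
  have VU: "variance ?U = variance ?L"
  proof -
    have "(2 * \<mu> - a - (2 * \<mu> - e))\<^sup>2 = (a - e)\<^sup>2" for a e :: real
      by (simp add: power2_commute)
    moreover have "(\<lambda>x. (x - (2 * \<mu> - expectation ?L))\<^sup>2) \<in> borel_measurable borel"
      by measurable
    note transfer(1)[OF this]
    ultimately show ?thesis
      unfolding EU by (simp only:)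
  qed
  let ?Z = "\<lambda>\<omega>. ?L \<omega> + ?U \<omega>"
  have EZ: "expectation ?Z = 2 * \<mu>"
    using iL iU EU by simp
  have VZ: "variance ?Z \<le> 4 * variance ?L"
    using variance_add_le[OF _ _ Min_square_integrable sqU] VU by simp
  \<comment> \<open>Reflecting all coordinates swaps the two summands, which is why their sum is
    symmetric although neither need be.\<close>
  have "distr M borel (\<lambda>\<omega>. (2 * \<mu> - ?U \<omega>) + (2 * \<mu> - ?L \<omega>)) = distr M borel ?Z"
    using iid_reflect[OF borel_measurable_add[OF mMin mMax]] by (simp add: Max_refl Min_refl)
  then have refl: "distr M borel (\<lambda>\<omega>. 2 * expectation ?Z - ?Z \<omega>) = distr M borel ?Z"
    unfolding EZ by (simp add: algebra_simps)
  have LU: "integrable M (\<lambda>\<omega>. ?L \<omega> * ?U \<omega>)"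
    by (rule integrable_mult_squares) (use Min_square_integrable sqU in auto)
  have sqZ: "integrable M (\<lambda>\<omega>. (?Z \<omega>)\<^sup>2)"
    using LU sqU Min_square_integrable by (simp add: power2_sum mult.assoc)
  have "prob {\<omega> \<in> space M. ?Z \<omega> \<le> 2 * t} \<le> variance ?Z / (2 * (expectation ?Z - 2 * t)\<^sup>2)"
    by (rule Chebyshev_one_sided_symmetric[OF _ sqZ refl]) (use t EZ in auto)
  \<comment> \<open>The distance from mean to threshold is \<open>2 * (\<mu> - t)\<close>; its
    square supplies the 4 that cancels the one in \<open>VZ\<close>.\<close>
  also have "\<dots> \<le> 4 * variance ?L / (2 * (2 * (\<mu> - t))\<^sup>2)"
    unfolding EZ right_diff_distrib[symmetric] by (rule divide_right_mono[OF VZ[unfolded EZ]]) simp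
  also have "\<dots> = variance ?L / (2 * (\<mu> - t)\<^sup>2)"
    unfolding power_mult_distrib by simp
  finally show ?thesis .
qed

end

end

text \<open>With \<open>t\<^sub>i = l\<^sub>i / (1 + l\<^sub>i)\<close>, the hypotheses of the two comparisons read
  \<open>k (\<mu> - t\<^sub>2) < \<mu> - t\<^sub>1\<close> and \<open>k (\<mu> - t\<^sub>2) > \<mu> - t\<^sub>1\<close>.\<close>

lemma ratio_condition_iff:
  fixes l1 l2 \<mu> k :: real
  assumes "l1 > 0" "l2 > 0" and pos: "k * (\<mu> - inverse (1 + inverse l2)) + 1 - \<mu> > 0"
  shows "l1 / l2 < inverse l2 * (inverse (k * (\<mu> - inverse (1 + inverse l2)) + 1 - \<mu>) - 1)
      \<longleftrightarrow> k * (\<mu> - inverse (1 + inverse l2)) < \<mu> - inverse (1 + inverse l1)"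
    and "l1 / l2 > inverse l2 * (inverse (k * (\<mu> - inverse (1 + inverse l2)) + 1 - \<mu>) - 1)
      \<longleftrightarrow> k * (\<mu> - inverse (1 + inverse l2)) > \<mu> - inverse (1 + inverse l1)"
proof -
  define A where "A = k * (\<mu> - inverse (1 + inverse l2)) + 1 - \<mu>"
  have A: "A > 0" using pos by (simp add: A_def)
  \<comment> \<open>In this form \<open>\<mu> - t\<^sub>1\<close> becomes
    \<open>inverse (1 + l1) - (1 - \<mu>)\<close>, ready for comparison with \<open>A\<close>, whose
    positivity permits taking reciprocals.\<close>
  have t: "inverse (1 + inverse l1) = 1 - inverse (1 + l1)"
    using \<open>l1 > 0\<close> by (simp add: field_simps)
  have scale: "inverse l2 * x < inverse l2 * y \<longleftrightarrow> x < y" for x y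
    using \<open>l2 > 0\<close> by simp
  have div: "l1 / l2 = inverse l2 * l1"
    by (simp add: field_simps)
  have "l1 / l2 < inverse l2 * (inverse A - 1) \<longleftrightarrow> 1 + l1 < inverse A"
    unfolding div using scale[of l1 "inverse A - 1"] by linarith
  also have "\<dots> \<longleftrightarrow> A < inverse (1 + l1)"
    using A \<open>l1 > 0\<close> by (simp add: field_simps)
  also have "\<dots> \<longleftrightarrow> k * (\<mu> - inverse (1 + inverse l2)) < \<mu> - inverse (1 + inverse l1)"
    unfolding A_def t by linarith
  finally show "l1 / l2 < inverse l2 * (inverse (k * (\<mu> - inverse (1 + inverse l2)) + 1 - \<mu>) - 1)
      \<longleftrightarrow> k * (\<mu> - inverse (1 + inverse l2)) < \<mu> - inverse (1 + inverse l1)"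
    by (simp only: A_def)
  have "l1 / l2 > inverse l2 * (inverse A - 1) \<longleftrightarrow> 1 + l1 > inverse A"
    unfolding div using scale[of "inverse A - 1" l1] by linarith
  also have "\<dots> \<longleftrightarrow> A > inverse (1 + l1)"
    using A \<open>l1 > 0\<close> by (simp add: field_simps)
  also have "\<dots> \<longleftrightarrow> k * (\<mu> - inverse (1 + inverse l2)) > \<mu> - inverse (1 + inverse l1)"
    unfolding A_def t by linarith
  finally show "l1 / l2 > inverse l2 * (inverse (k * (\<mu> - inverse (1 + inverse l2)) + 1 - \<mu>) - 1)
      \<longleftrightarrow> k * (\<mu> - inverse (1 + inverse l2)) > \<mu> - inverse (1 + inverse l1)"
    by (simp only: A_def)
qed

theorem corollary5:
  fixes M :: "'a measure"
    and \<epsilon> :: "'a \<Rightarrow> real ^ 'd"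
    and f :: "'n::finite \<Rightarrow> real ^ 'd \<Rightarrow> real ^ 'c::finite"
    and w :: "real ^ 'n"
    and x0 :: "real ^ 'd"
    and y0 :: 'c
    and X :: "'n \<Rightarrow> 'a \<Rightarrow> real"
    and l1 l2 p \<mu> s sf :: real
  assumes "prob_space M"
    and "\<epsilon> \<in> borel_measurable M"
    and "CARD('c) \<ge> 2"
    and "\<And>i x. f i x \<in> simplex_vecs"
    and "\<And>i. (\<lambda>\<omega>. f i (x0 + \<epsilon> \<omega>)) \<in> borel_measurable M"
    and "\<And>j. w $ j > 0"
    and "l1 > 0" and "l2 > 0"
    and "WE_confident M \<epsilon> l1 p w f x0 y0"
    and "MME_confident M \<epsilon> l2 p f x0 y0"
    and X: "X = (\<lambda>i \<omega>. f i (x0 + \<epsilon> \<omega>) $ y0)"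
    and "iid M X"
    and "\<And>i. symmetric_distribution (distr M borel (X i))"
    and "\<And>i. prob_space.expectation M (X i) = \<mu>"
    and "\<And>i. prob_space.variance M (X i) = s\<^sup>2"
    and "\<mu> > max (inverse (1 + inverse l1)) (inverse (1 + inverse l2))"
    and "sf \<ge> 0" and "sf\<^sup>2 = prob_space.variance M (\<lambda>\<omega>. MIN i. X i \<omega>)"
    and "sf < s"
  shows "WE_certified p l1 \<mu> s w
           \<le> measure M {\<omega> \<in> space M. weighted_ensemble w f (x0 + \<epsilon> \<omega>) = y0}
    \<and> MME_certified p l2 \<mu> sf
           \<le> measure M {\<omega> \<in> space M. max_margin_ensemble f (x0 + \<epsilon> \<omega>) = y0}
    \<and> (l1 / l2 < inverse l2 *
           (inverse (s / sf * (\<mu> - inverse (1 + inverse l2)) + 1 - \<mu>) - 1)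
         \<longrightarrow> WE_certified p l1 \<mu> s w > MME_certified p l2 \<mu> sf)
    \<and> (l1 / l2 > inverse l2 *
           (inverse (s / (sqrt (real CARD('n)) * sf) * (\<mu> - inverse (1 + inverse l2)) + 1 - \<mu>) - 1)
         \<longrightarrow> MME_certified p l2 \<mu> sf > WE_certified p l1 \<mu> s w)"
proof -
  interpret prob_space M by fact
  note pos = assms(6) and l1 = assms(7) and l2 = assms(8)
    and iid = assms(12) and sym = assms(13) and mean = assms(14) and var = assms(15)
  define t1 t2 where "t1 = inverse (1 + inverse l1)" and "t2 = inverse (1 + inverse l2)"
  have t1: "t1 < \<mu>" and t2: "t2 < \<mu>" using assms(16) by (auto simp: t1_def t2_def)
  have s: "s > 0" using assms(17,19) by simp
  have [measurable]: "(\<lambda>\<omega>. f i (x0 + \<epsilon> \<omega>) $ y) \<in> borel_measurable M" for i y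
    using measurable_compose[OF assms(5) borel_measurable_nth] .
  have Xb: "0 \<le> X i \<omega>" "X i \<omega> \<le> 1" for i \<omega>
    unfolding X using simplex_vecs_bounds[OF assms(4)] by auto
  have [measurable]: "random_variable borel (X i)" for i
    unfolding X by simp
  have bnd: "\<bar>X i \<omega>\<bar> \<le> 1" "\<bar>(X i \<omega>)\<^sup>2\<bar> \<le> 1" for i \<omega>
    using Xb[of i \<omega>] by (auto simp: abs_square_le_1)
  have int: "integrable M (X i)" and sq: "integrable M (\<lambda>\<omega>. (X i \<omega>)\<^sup>2)" for i
    by (rule integrable_const_bound[where B = 1]; use bnd in auto)+
  \<comment> \<open>This keeps \<open>1 - \<mu>\<close> nonnegative, hence the terms inverted in
    both comparisons positive.\<close>
  have \<mu>1: "\<mu> \<le> 1"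
    using integral_le_const[OF int] Xb mean by (metis AE_I2)
  have sf: "sf > 0"
  proof (rule ccontr)
    assume "\<not> sf > 0"
    with assms(17,18) have "variance (\<lambda>\<omega>. MIN i. X i \<omega>) = 0" by simp
    from iid_variance_Min_eq_0[OF iid Min_square_integrable[OF iid sym mean sq] this] var s
    show False by simp
  qed

  \<comment> \<open>Errors of the weighted ensemble are charged to failure of confidence and to the
    lower tail of the weighted sum.\<close>
  have "(1 - p) - (norm w)\<^sup>2 / (l1_norm w)\<^sup>2 * (s\<^sup>2 / (2 * (\<mu> - t1)\<^sup>2))
      \<le> prob {\<omega> \<in> space M. (MAX y\<in>UNIV - {y0}. \<Sum>i\<in>UNIV. w $ i * f i (x0 + \<epsilon> \<omega>) $ y)
         \<le> l1 * (\<Sum>i\<in>UNIV. w $ i * (1 - f i (x0 + \<epsilon> \<omega>) $ y0))}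
       - prob {\<omega> \<in> space M. (\<Sum>i\<in>UNIV. w $ i * X i \<omega>) \<le> l1_norm w * t1}"
    using assms(9) weighted_sum_tail[OF iid sym mean sq pos var t1]
    by (simp add: WE_confident_def)
  also have "\<dots> \<le> prob {\<omega> \<in> space M. weighted_ensemble w f (x0 + \<epsilon> \<omega>) = y0}"
  proof (rule prob_ge_diff)
    have [measurable]: "(\<lambda>\<omega>. weighted_ensemble w f (x0 + \<epsilon> \<omega>)) \<in> measurable M (count_space UNIV)"
      unfolding weighted_ensemble_def by (rule measurable_arg_max) auto
    show "{\<omega> \<in> space M. weighted_ensemble w f (x0 + \<epsilon> \<omega>) = y0} \<in> events"
      by measurable
    show "{\<omega> \<in> space M. (MAX y\<in>UNIV - {y0}. \<Sum>i\<in>UNIV. w $ i * f i (x0 + \<epsilon> \<omega>) $ y)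
         \<le> l1 * (\<Sum>i\<in>UNIV. w $ i * (1 - f i (x0 + \<epsilon> \<omega>) $ y0))}
      \<subseteq> {\<omega> \<in> space M. weighted_ensemble w f (x0 + \<epsilon> \<omega>) = y0}
        \<union> {\<omega> \<in> space M. (\<Sum>i\<in>UNIV. w $ i * X i \<omega>) \<le> l1_norm w * t1}"
      (is "?conf \<subseteq> ?R")
    proof
      fix \<omega> assume "\<omega> \<in> ?conf"
      then show "\<omega> \<in> ?R"
        using weighted_ensemble_correct[OF _ l1 pos, of f "x0 + \<epsilon> \<omega>" y0] by (simp add: X t1_def) linarith
    qed
    have "(\<lambda>\<omega>. MAX y\<in>UNIV - {y0}. \<Sum>i\<in>UNIV. w $ i * f i (x0 + \<epsilon> \<omega>) $ y) \<in> borel_measurable M"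
      by (rule borel_measurable_Max) simp_all
    then show "{\<omega> \<in> space M. (MAX y\<in>UNIV - {y0}. \<Sum>i\<in>UNIV. w $ i * f i (x0 + \<epsilon> \<omega>) $ y)
         \<le> l1 * (\<Sum>i\<in>UNIV. w $ i * (1 - f i (x0 + \<epsilon> \<omega>) $ y0))} \<in> events"
      by (rule borel_measurable_le) simp
    show "{\<omega> \<in> space M. (\<Sum>i\<in>UNIV. w $ i * X i \<omega>) \<le> l1_norm w * t1} \<in> events"
      by (rule borel_measurable_le) simp_all
  qed
  finally have WE: "WE_certified p l1 \<mu> s w
      \<le> prob {\<omega> \<in> space M. weighted_ensemble w f (x0 + \<epsilon> \<omega>) = y0}"
    by (simp add: WE_certified_def t1_def)

  have "(1 - p) - sf\<^sup>2 / (2 * (\<mu> - t2)\<^sup>2)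
      \<le> prob {\<omega> \<in> space M. \<forall>i. (MAX y\<in>UNIV - {y0}. f i (x0 + \<epsilon> \<omega>) $ y)
             \<le> l2 * (1 - f i (x0 + \<epsilon> \<omega>) $ y0)}
       - prob {\<omega> \<in> space M. (MIN i. X i \<omega>) + (MAX i. X i \<omega>) \<le> 2 * t2}"
    using assms(10) Min_plus_Max_tail[OF iid sym mean sq t2] unfolding assms(18)
    by (simp add: MME_confident_def)
  also have "\<dots> \<le> prob {\<omega> \<in> space M. max_margin_ensemble f (x0 + \<epsilon> \<omega>) = y0}"
  proof (rule prob_ge_diff)
    have pred [measurable]: "(\<lambda>\<omega>. prediction (f i) (x0 + \<epsilon> \<omega>)) \<in> measurable M (count_space UNIV)" for i
      unfolding prediction_def by (rule measurable_arg_max) auto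
    have run [measurable]: "(\<lambda>\<omega>. runner_up (f i) (x0 + \<epsilon> \<omega>)) \<in> measurable M (count_space UNIV)" for i
      unfolding runner_up_def by (rule measurable_arg_max) auto
    \<comment> \<open>The coordinate being read is itself random; as it takes finitely many values,
      measurability can be checked for each fixed label.\<close>
    have [measurable]: "(\<lambda>\<omega>. margin (f i) (x0 + \<epsilon> \<omega>)) \<in> borel_measurable M" for i
      unfolding margin_def
      by (rule borel_measurable_diff; rule measurable_compose_countable[OF _ pred]
          measurable_compose_countable[OF _ run]; measurable)
    have c: "(\<lambda>\<omega>. ARG_MAX (\<lambda>i. margin (f i) (x0 + \<epsilon> \<omega>)) i. True) \<in> measurable M (count_space UNIV)"
      by (rule measurable_arg_max) auto
    have [measurable]: "(\<lambda>\<omega>. max_margin_ensemble f (x0 + \<epsilon> \<omega>)) \<in> measurable M (count_space UNIV)"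
      unfolding max_margin_ensemble_def
      by (rule measurable_compose_countable[OF _ c]) (rule pred)
    show "{\<omega> \<in> space M. max_margin_ensemble f (x0 + \<epsilon> \<omega>) = y0} \<in> events"
      by measurable
    show "{\<omega> \<in> space M. \<forall>i. (MAX y\<in>UNIV - {y0}. f i (x0 + \<epsilon> \<omega>) $ y)
             \<le> l2 * (1 - f i (x0 + \<epsilon> \<omega>) $ y0)}
      \<subseteq> {\<omega> \<in> space M. max_margin_ensemble f (x0 + \<epsilon> \<omega>) = y0}
        \<union> {\<omega> \<in> space M. (MIN i. X i \<omega>) + (MAX i. X i \<omega>) \<le> 2 * t2}"
      (is "?conf \<subseteq> ?R")
    proof
      fix \<omega> assume "\<omega> \<in> ?conf"
      then show "\<omega> \<in> ?R"
        using max_margin_ensemble_correct[OF _ l2 assms(3), of f "x0 + \<epsilon> \<omega>" y0] by (simp add: X t2_def) linarith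
    qed
    have "(\<lambda>\<omega>. MAX y\<in>UNIV - {y0}. f i (x0 + \<epsilon> \<omega>) $ y) \<in> borel_measurable M" for i
      by (rule borel_measurable_Max) simp_all
    then have "{\<omega> \<in> space M. (MAX y\<in>UNIV - {y0}. f i (x0 + \<epsilon> \<omega>) $ y)
             \<le> l2 * (1 - f i (x0 + \<epsilon> \<omega>) $ y0)} \<in> events" for i
      by (rule borel_measurable_le) simp
    then show "{\<omega> \<in> space M. \<forall>i. (MAX y\<in>UNIV - {y0}. f i (x0 + \<epsilon> \<omega>) $ y)
             \<le> l2 * (1 - f i (x0 + \<epsilon> \<omega>) $ y0)} \<in> events"
      by (rule sets.sets_Collect_countable_All)
    show "{\<omega> \<in> space M. (MIN i. X i \<omega>) + (MAX i. X i \<omega>) \<le> 2 * t2} \<in> events"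
      by (rule borel_measurable_le) simp_all
  qed
  finally have MME: "MME_certified p l2 \<mu> sf
      \<le> prob {\<omega> \<in> space M. max_margin_ensemble f (x0 + \<epsilon> \<omega>) = y0}"
    by (simp add: MME_certified_def t2_def)

  have W: "l1_norm w > 0"
    unfolding l1_norm_def by (rule sum_pos) (use pos in \<open>auto simp: less_imp_neq[symmetric]\<close>)
  define r where "r = (norm w)\<^sup>2 / (l1_norm w)\<^sup>2"
  define N where "N = real CARD('n)"
  have N: "N > 0" by (simp add: N_def)
  have r1: "r \<le> 1"
    using l1_norm_bounds(1)[of w] W by (simp add: r_def power_mono)
  have rN: "inverse N \<le> r"
    using l1_norm_bounds(2)[of w] W N unfolding r_def N_def[symmetric] by (simp add: field_simps)
  have r0: "r > 0" using rN N by (meson inverse_positive_iff_positive less_le_trans)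
  \<comment> \<open>Both certificates now have the same shape, so the comparison is between
    \<open>r * A\<close> and \<open>B\<close>.\<close>
  define A B where "A = s\<^sup>2 / (\<mu> - t1)\<^sup>2" and "B = sf\<^sup>2 / (\<mu> - t2)\<^sup>2"
  have cert: "WE_certified p l1 \<mu> s w = 1 - p - r * A / 2"
      "MME_certified p l2 \<mu> sf = 1 - p - B / 2"
    by (simp_all add: WE_certified_def MME_certified_def r_def t1_def t2_def A_def B_def)

  have i: "WE_certified p l1 \<mu> s w > MME_certified p l2 \<mu> sf"
    if "l1 / l2 < inverse l2 * (inverse (s / sf * (\<mu> - t2) + 1 - \<mu>) - 1)"
  proof -
    have "s / sf * (\<mu> - t2) + 1 - \<mu> > 0" using s sf t2 \<mu>1 by (simp add: add_pos_nonneg add_diff_eq[symmetric])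
    with that l1 l2 have "s / sf * (\<mu> - t2) < \<mu> - t1"
      unfolding t1_def t2_def by (subst (asm) ratio_condition_iff(1)) auto
    then have "s * (\<mu> - t2) < sf * (\<mu> - t1)" using sf by (simp add: field_simps)
    then have "(s * (\<mu> - t2))\<^sup>2 < (sf * (\<mu> - t1))\<^sup>2"
      using s t2 by (intro power_strict_mono) auto
    then have "A < B"
      using t1 t2 by (simp add: A_def B_def divide_simps power_mult_distrib)
    \<comment> \<open>The upper bound on \<open>r\<close> holds for all weights, so
      \<open>A < B\<close> suffices.\<close>
    moreover have "r * A \<le> A"
      using r1 r0 by (intro mult_left_le_one_le) (auto simp: A_def)
    ultimately show ?thesis unfolding cert by linarith
  qed
  have ii: "MME_certified p l2 \<mu> sf > WE_certified p l1 \<mu> s w"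
    if "l1 / l2 > inverse l2 * (inverse (s / (sqrt N * sf) * (\<mu> - t2) + 1 - \<mu>) - 1)"
  proof -
    have "s / (sqrt N * sf) * (\<mu> - t2) + 1 - \<mu> > 0"
      using s sf t2 \<mu>1 N by (simp add: add_pos_nonneg add_diff_eq[symmetric])
    with that l1 l2 have "s / (sqrt N * sf) * (\<mu> - t2) > \<mu> - t1"
      unfolding t1_def t2_def by (subst (asm) ratio_condition_iff(2)) auto
    then have "sqrt N * sf * (\<mu> - t1) < s * (\<mu> - t2)" using sf N by (simp add: field_simps)
    then have "(sqrt N * sf * (\<mu> - t1))\<^sup>2 < (s * (\<mu> - t2))\<^sup>2"
      using sf N t1 by (intro power_strict_mono) auto
    then have "B < inverse N * A"
      using t1 t2 N by (simp add: A_def B_def divide_simps power_mult_distrib mult_ac)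
    \<comment> \<open>The lower bound \<open>inverse N\<close> on \<open>r\<close> is uniform in the
      weights; it accounts for the factor \<open>sqrt N\<close> in the condition.\<close>
    also have "\<dots> \<le> r * A"
      using rN by (intro mult_right_mono) (auto simp: A_def)
    finally show ?thesis unfolding cert by linarith
  qed
  show ?thesis
    using WE MME i ii unfolding t1_def t2_def N_def by blast
qed

end
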